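(* Let $R$ be a commutative ring. Then every mononoetherian $R$-module has finite uniform dimension.
   Context: Rings have identity and modules are unitary. A module $A$ is embedded in a module $B$ if there is an injective homomorphism $A\to B$. A module $M$ is mononoetherian if for every ascending chain $M_1\subseteq M_2\subseteq\cdots$ of submodules of $M$ there exists $n\ge1$ such that $M_i$ is embedded in $M_n$ for every $i\ge n$. A module has finite uniform dimension if it contains no infinite direct sum of non-zero submodules. *)

theory Defs
  imports "HOL-Algebra.Module"
begin

definition module_hom ::
  "('a, 'm) ring_scheme \<Rightarrow> ('a, 'b, 'n) module_scheme \<Rightarrow> ('a, 'c, 'k) module_scheme \<Rightarrow> ('b \<Rightarrow> 'c) set"
  where
  "module_hom R A B =
     {f. f \<in> carrier A \<rightarrow> carrier B \<and>
         (\<forall>x\<in>carrier A. \<forall>y\<in>carrier A. f (x \<oplus>\<^bsub>A\<^esub> y) = f x \<oplus>\<^bsub>B\<^esub> f y) \<and>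
         (\<forall>r\<in>carrier R. \<forall>x\<in>carrier A. f (r \<odot>\<^bsub>A\<^esub> x) = r \<odot>\<^bsub>B\<^esub> f x)}"

definition module_embedded ::
  "('a, 'm) ring_scheme \<Rightarrow> ('a, 'b, 'n) module_scheme \<Rightarrow> ('a, 'c, 'k) module_scheme \<Rightarrow> bool"
  where
  "module_embedded R A B \<longleftrightarrow> (\<exists>f\<in>module_hom R A B. inj_on f (carrier A))"

text \<open>Chains are indexed from \<open>0\<close> instead of \<open>1\<close>. A submodule \<open>H\<close> of \<open>M\<close> is regarded as
  the module \<open>M\<lparr>carrier := H\<rparr>\<close>.\<close>

definition mononoetherian :: "('a, 'm) ring_scheme \<Rightarrow> ('a, 'b, 'n) module_scheme \<Rightarrow> bool" where
  "mononoetherian R M \<longleftrightarrow>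
     (\<forall>N :: nat \<Rightarrow> 'b set.
        (\<forall>i. submodule (N i) R M) \<and> (\<forall>i. N i \<subseteq> N (Suc i)) \<longrightarrow>
        (\<exists>n. \<forall>i\<ge>n. module_embedded R (M\<lparr>carrier := N i\<rparr>) (M\<lparr>carrier := N n\<rparr>)))"

text \<open>The sum of a set \<open>S\<close> of submodules is direct iff every element of it has a unique
  representation as a finite sum of elements of the members of \<open>S\<close>, i.e. iff only the trivial
  representation of zero exists. Here \<open>x\<close> selects one element from each summand.\<close>

definition direct_sum_of_submodules ::
  "('a, 'm) ring_scheme \<Rightarrow> ('a, 'b, 'n) module_scheme \<Rightarrow> 'b set set \<Rightarrow> bool" where
  "direct_sum_of_submodules R M S \<longleftrightarrow>
     (\<forall>N\<in>S. submodule N R M) \<and>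
     (\<forall>F x. finite F \<and> F \<subseteq> S \<and> (\<forall>N\<in>F. x N \<in> N) \<and> (\<Oplus>\<^bsub>M\<^esub>N\<in>F. x N) = \<zero>\<^bsub>M\<^esub>
        \<longrightarrow> (\<forall>N\<in>F. x N = \<zero>\<^bsub>M\<^esub>))"

text \<open>Non-zero summands of a direct sum are pairwise distinct, so an infinite direct sum of
  non-zero submodules is given by an infinite set of submodules rather than by an indexed family.\<close>

definition finite_uniform_dimension ::
  "('a, 'm) ring_scheme \<Rightarrow> ('a, 'b, 'n) module_scheme \<Rightarrow> bool" where
  "finite_uniform_dimension R M \<longleftrightarrow>
     \<not> (\<exists>S. infinite S \<and> (\<forall>N\<in>S. N \<noteq> {\<zero>\<^bsub>M\<^esub>}) \<and> direct_sum_of_submodules R M S)"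

end

theory Submission
  imports Defs "HOL-Algebra.Ideal"
begin

text \<open>
  If \<open>ann (s\<^sub>0 x) \<subset> ann (s\<^sub>1 x) \<subset> \<dots>\<close> then the submodules \<open>ann (s\<^sub>n x) x\<close> ascend, and
  \<open>s\<^sub>n\<close> kills the \<open>n\<close>-th but not the next one, so the latter does not embed in the former.
  Hence in a mononoetherian module over a commutative ring annihilators of multiples of a given
  vector satisfy the ascending chain condition, and every non-zero submodule contains a copy of
  \<open>R/P\<close> for some prime \<open>P\<close>. An infinite direct sum of non-zero submodules therefore contains
  \<open>R/P\<^sub>0 \<oplus> R/P\<^sub>1 \<oplus> \<dots>\<close>, where we may take the primes to be either pairwise distinct
  or all equal. For some \<open>n\<close> the sum of the first \<open>n + 1\<close> summands embeds in the sum of the first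
  \<open>n\<close>. In the first case this contradicts that the associated primes of the latter are
  \<open>P\<^sub>0, \<dots>, P\<^sub>n\<^sub>-\<^sub>1\<close>, and in the second case it contradicts the invariance of rank over
  the domain \<open>R/P\<close>.
\<close>

context module
begin

section \<open>Annihilators of vectors and when they are prime\<close>

definition ann :: "'c \<Rightarrow> 'a set" where
  "ann x = {r \<in> carrier R. r \<odot>\<^bsub>M\<^esub> x = \<zero>\<^bsub>M\<^esub>}"

lemma smult_commute:
  assumes "a \<in> carrier R" "b \<in> carrier R" "x \<in> carrier M"
  shows "a \<odot>\<^bsub>M\<^esub> (b \<odot>\<^bsub>M\<^esub> x) = b \<odot>\<^bsub>M\<^esub> (a \<odot>\<^bsub>M\<^esub> x)"
  using assms by (simp add: R.m_comm flip: smult_assoc1)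

lemma ideal_ann:
  assumes "x \<in> carrier M"
  shows "ideal (ann x) R"
proof (rule idealI)
  show "ring R" by (rule R.ring_axioms)
  show "subgroup (ann x) (add_monoid R)"
  proof (rule R.add.subgroupI)
    show "ann x \<subseteq> carrier R" "ann x \<noteq> {}"
      using assms by (auto simp: ann_def intro!: exI[of _ "\<zero>"])
  next
    fix a assume "a \<in> ann x"
    then show "\<ominus> a \<in> ann x" using assms by (simp add: ann_def smult_l_minus)
  next
    fix a b assume "a \<in> ann x" "b \<in> ann x"
    then show "a \<oplus> b \<in> ann x" using assms by (simp add: ann_def smult_l_distr)
  qed
next
  fix a b assume ab: "a \<in> ann x" "b \<in> carrier R"
  then show "b \<otimes> a \<in> ann x" using assms by (simp add: ann_def smult_assoc1)
  then show "a \<otimes> b \<in> ann x" using ab by (simp add: ann_def R.m_comm)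
qed

lemma ann_smult_mono:
  assumes "x \<in> carrier M" "r \<in> carrier R"
  shows "ann x \<subseteq> ann (r \<odot>\<^bsub>M\<^esub> x)"
  using assms by (auto simp: ann_def smult_commute[of _ r x])

text \<open>If \<open>ab\<close> kills \<open>x\<close> and \<open>bx\<close> is non-zero, then
  \<open>a\<close> kills \<open>bx\<close>, whose annihilator contains that of \<open>x\<close> and
  so, by maximality, equals it.\<close>

lemma primeideal_ann_if_maximal:
  assumes x: "x \<in> carrier M" "x \<noteq> \<zero>\<^bsub>M\<^esub>"
    and max: "\<And>r. r \<in> carrier R \<Longrightarrow> r \<odot>\<^bsub>M\<^esub> x \<noteq> \<zero>\<^bsub>M\<^esub> \<Longrightarrow> \<not> ann x \<subset> ann (r \<odot>\<^bsub>M\<^esub> x)"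
  shows "primeideal (ann x) R"
proof (rule primeidealI[OF ideal_ann[OF x(1)] R.is_cring])
  show "carrier R \<noteq> ann x" using x by (force simp: ann_def)
next
  fix a b assume ab: "a \<in> carrier R" "b \<in> carrier R" "a \<otimes> b \<in> ann x"
  then have "a \<in> ann (b \<odot>\<^bsub>M\<^esub> x)" using x by (simp add: ann_def smult_assoc1)
  then show "a \<in> ann x \<or> b \<in> ann x"
    using ab x max[of b] ann_smult_mono[of x b] by (auto simp: ann_def)
qed

text \<open>The cyclic module \<open>Rx\<close> is a copy of the domain \<open>R/P\<close> with
  \<open>P = ann x\<close>, so only elements of \<open>P\<close> kill a non-zero vector in
  it.\<close>

lemma ann_smult_of_prime:
  assumes x: "x \<in> carrier M" "primeideal (ann x) R"
    and r: "r \<in> carrier R" "r \<odot>\<^bsub>M\<^esub> x \<noteq> \<zero>\<^bsub>M\<^esub>"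
  shows "ann (r \<odot>\<^bsub>M\<^esub> x) = ann x"
proof -
  have "s \<in> ann x" if s: "s \<in> ann (r \<odot>\<^bsub>M\<^esub> x)" for s
  proof -
    have sr: "s \<in> carrier R" "s \<otimes> r \<in> ann x" using s r x(1) by (simp_all add: ann_def smult_assoc1)
    moreover have "r \<notin> ann x" using r by (simp add: ann_def)
    ultimately show ?thesis using primeideal.I_prime[OF x(2) sr(1) r(1) sr(2)] by blast
  qed
  then show ?thesis using ann_smult_mono[OF x(1) r(1)] by blast
qed

section \<open>Homomorphisms between submodules\<close>

lemma submodule_zero_mem:
  assumes "submodule A R M" shows "\<zero>\<^bsub>M\<^esub> \<in> A"
  using subgroup.one_closed[OF submodule.axioms(1)[OF assms]] by simp

lemma module_hom_restrict_smult:
  assumes "f \<in> module_hom R (M\<lparr>carrier := A\<rparr>) (M\<lparr>carrier := B\<rparr>)" "r \<in> carrier R" "x \<in> A"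
  shows "f (r \<odot>\<^bsub>M\<^esub> x) = r \<odot>\<^bsub>M\<^esub> f x"
  using assms by (auto simp: module_hom_def)

lemma module_hom_restrict_zero:
  assumes f: "f \<in> module_hom R (M\<lparr>carrier := A\<rparr>) (M\<lparr>carrier := B\<rparr>)"
    and A: "submodule A R M" and B: "submodule B R M"
  shows "f \<zero>\<^bsub>M\<^esub> = \<zero>\<^bsub>M\<^esub>"
proof -
  have 0: "\<zero>\<^bsub>M\<^esub> \<in> A" by (rule submodule_zero_mem[OF A])
  then have "f \<zero>\<^bsub>M\<^esub> \<in> carrier M" using f submoduleE(1)[OF B] by (auto simp: module_hom_def)
  \<comment> \<open>Linearity with the scalar \<open>\<zero>\<close> yields preservation of
    zero.\<close>
  moreover have "f (\<zero> \<odot>\<^bsub>M\<^esub> \<zero>\<^bsub>M\<^esub>) = \<zero> \<odot>\<^bsub>M\<^esub> f \<zero>\<^bsub>M\<^esub>"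
    by (rule module_hom_restrict_smult[OF f R.zero_closed 0])
  ultimately show ?thesis by simp
qed

text \<open>\<open>f\<close> is only known to be additive on \<open>A\<close>, so the induction
  carries membership of the partial sums in \<open>A\<close> along with the formula.\<close>

lemma module_hom_restrict_finsum:
  assumes f: "f \<in> module_hom R (M\<lparr>carrier := A\<rparr>) (M\<lparr>carrier := B\<rparr>)"
    and A: "submodule A R M" and B: "submodule B R M"
    and J: "finite J" "\<And>j. j \<in> J \<Longrightarrow> x j \<in> A"
  shows "(\<Oplus>\<^bsub>M\<^esub>j\<in>J. x j) \<in> A \<and> f (\<Oplus>\<^bsub>M\<^esub>j\<in>J. x j) = (\<Oplus>\<^bsub>M\<^esub>j\<in>J. f (x j))"
  using J
proof (induction J rule: finite_induct)
  case empty
  then show ?case using module_hom_restrict_zero[OF f A B] submodule_zero_mem[OF A] by simp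
next
  case (insert j J)
  have sub: "A \<subseteq> carrier M" "\<And>z. z \<in> A \<Longrightarrow> f z \<in> carrier M"
    using f submoduleE(1)[OF A] submoduleE(1)[OF B] by (auto simp: module_hom_def)
  have "(\<Oplus>\<^bsub>M\<^esub>i\<in>insert j J. x i) = x j \<oplus>\<^bsub>M\<^esub> (\<Oplus>\<^bsub>M\<^esub>i\<in>J. x i)"
    using insert sub by (intro M.finsum_insert) auto
  moreover have "(\<Oplus>\<^bsub>M\<^esub>i\<in>insert j J. f (x i)) = f (x j) \<oplus>\<^bsub>M\<^esub> (\<Oplus>\<^bsub>M\<^esub>i\<in>J. f (x i))"
    using insert sub by (intro M.finsum_insert) auto
  moreover have "f (u \<oplus>\<^bsub>M\<^esub> v) = f u \<oplus>\<^bsub>M\<^esub> f v" if "u \<in> A" "v \<in> A" for u v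
    using f that by (simp add: module_hom_def)
  moreover have "x j \<in> A" "(\<Oplus>\<^bsub>M\<^esub>i\<in>J. x i) \<in> A"
    and "f (\<Oplus>\<^bsub>M\<^esub>i\<in>J. x i) = (\<Oplus>\<^bsub>M\<^esub>i\<in>J. f (x i))"
    using insert by auto
  ultimately show ?case using submoduleE(5)[OF A] by metis
qed

section \<open>Chain condition for annihilators of multiples of a vector\<close>

lemma submodule_smult_ideal:
  assumes "ideal I R" and x: "x \<in> carrier M"
  shows "submodule ((\<lambda>a. a \<odot>\<^bsub>M\<^esub> x) ` I) R M"
proof -
  note I_add = ideal.axioms(1)[OF assms(1)]
  have sub: "I \<subseteq> carrier R" by (rule additive_subgroup.a_subset[OF I_add])
  show ?thesis
  proof (rule submoduleI)
    show "(\<lambda>a. a \<odot>\<^bsub>M\<^esub> x) ` I \<subseteq> carrier M" using sub x by auto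
    show "\<zero>\<^bsub>M\<^esub> \<in> (\<lambda>a. a \<odot>\<^bsub>M\<^esub> x) ` I"
      using x additive_subgroup.zero_closed[OF I_add] by (intro image_eqI[of _ _ "\<zero>"]) simp_all
  next
    fix u assume "u \<in> (\<lambda>a. a \<odot>\<^bsub>M\<^esub> x) ` I"
    then obtain a where "a \<in> I" "u = a \<odot>\<^bsub>M\<^esub> x" by auto
    then show "\<ominus>\<^bsub>M\<^esub> u \<in> (\<lambda>a. a \<odot>\<^bsub>M\<^esub> x) ` I"
      using sub x by (intro image_eqI[of _ _ "\<ominus> a"])
        (auto simp: smult_l_minus additive_subgroup.a_inv_closed[OF I_add])
  next
    fix u v assume "u \<in> (\<lambda>a. a \<odot>\<^bsub>M\<^esub> x) ` I" "v \<in> (\<lambda>a. a \<odot>\<^bsub>M\<^esub> x) ` I"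
    then obtain a b where "a \<in> I" "u = a \<odot>\<^bsub>M\<^esub> x" "b \<in> I" "v = b \<odot>\<^bsub>M\<^esub> x" by auto
    then show "u \<oplus>\<^bsub>M\<^esub> v \<in> (\<lambda>a. a \<odot>\<^bsub>M\<^esub> x) ` I"
      using sub x by (intro image_eqI[of _ _ "a \<oplus> b"])
        (auto simp: smult_l_distr subset_eq additive_subgroup.a_closed[OF I_add])
  next
    fix r u assume "r \<in> carrier R" "u \<in> (\<lambda>a. a \<odot>\<^bsub>M\<^esub> x) ` I"
    then obtain a where "r \<in> carrier R" "a \<in> I" "u = a \<odot>\<^bsub>M\<^esub> x" by auto
    then show "r \<odot>\<^bsub>M\<^esub> u \<in> (\<lambda>a. a \<odot>\<^bsub>M\<^esub> x) ` I"
      using sub x by (intro image_eqI[of _ _ "r \<otimes> a"])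
        (auto simp: smult_assoc1 ideal.I_l_closed[OF assms(1)] subset_eq)
  qed
qed

lemma mononoetherian_no_ann_chain:
  assumes M: "mononoetherian R M" and x: "x \<in> carrier M"
    and s: "\<And>n::nat. s n \<in> carrier R"
    and chain: "\<And>n. ann (s n \<odot>\<^bsub>M\<^esub> x) \<subset> ann (s (Suc n) \<odot>\<^bsub>M\<^esub> x)"
  shows False
proof -
  define N where "N n = (\<lambda>a. a \<odot>\<^bsub>M\<^esub> x) ` ann (s n \<odot>\<^bsub>M\<^esub> x)" for n
  have N: "submodule (N n) R M" for n
    unfolding N_def using x s by (intro submodule_smult_ideal ideal_ann) auto
  moreover have "N n \<subseteq> N (Suc n)" for n
    using chain[of n] by (auto simp: N_def)
  ultimately obtain n where "module_embedded R (M\<lparr>carrier := N (Suc n)\<rparr>) (M\<lparr>carrier := N n\<rparr>)"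
    using M unfolding mononoetherian_def by (meson le_SucI order_refl)
  then obtain f where f: "f \<in> module_hom R (M\<lparr>carrier := N (Suc n)\<rparr>) (M\<lparr>carrier := N n\<rparr>)"
    and inj: "inj_on f (N (Suc n))"
    by (auto simp: module_embedded_def)
  \<comment> \<open>Strictness of the chain supplies \<open>t\<close> such that \<open>t x\<close>
    lies in \<open>N (Suc n)\<close> but is not killed by \<open>s n\<close>.\<close>
  obtain t where t: "t \<in> carrier R" "t \<in> ann (s (Suc n) \<odot>\<^bsub>M\<^esub> x)" "t \<notin> ann (s n \<odot>\<^bsub>M\<^esub> x)"
    using chain[of n] by (auto simp: ann_def)
  have tx: "t \<odot>\<^bsub>M\<^esub> x \<in> N (Suc n)" using t by (auto simp: N_def)
  then have "f (t \<odot>\<^bsub>M\<^esub> x) \<in> N n" using f by (auto simp: module_hom_def)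
  then obtain a where a: "a \<in> ann (s n \<odot>\<^bsub>M\<^esub> x)" "f (t \<odot>\<^bsub>M\<^esub> x) = a \<odot>\<^bsub>M\<^esub> x"
    by (auto simp: N_def)
  \<comment> \<open>Commutativity of \<open>R\<close> enters: since \<open>a\<close> kills
    \<open>s n x\<close>, \<open>s n\<close> kills \<open>a x\<close>.\<close>
  then have "s n \<odot>\<^bsub>M\<^esub> f (t \<odot>\<^bsub>M\<^esub> x) = \<zero>\<^bsub>M\<^esub>"
    using x s[of n] smult_commute[of a "s n" x] by (simp add: ann_def)
  then have "f (s n \<odot>\<^bsub>M\<^esub> (t \<odot>\<^bsub>M\<^esub> x)) = f \<zero>\<^bsub>M\<^esub>"
    using module_hom_restrict_smult[OF f s tx] module_hom_restrict_zero[OF f N N] by simp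
  then have "s n \<odot>\<^bsub>M\<^esub> (t \<odot>\<^bsub>M\<^esub> x) = \<zero>\<^bsub>M\<^esub>"
    using inj submoduleE(4)[OF N s tx] submodule_zero_mem[OF N] by (auto dest: inj_onD)
  then show False
    using t x s[of n] smult_commute[of t "s n" x] by (simp add: ann_def)
qed

text \<open>By the chain condition, a non-zero vector of \<open>N\<close> has among its non-zero
  multiples one with maximal annihilator, and such an annihilator is prime.\<close>

lemma mononoetherian_prime_ann:
  assumes M: "mononoetherian R M" and N: "submodule N R M" "N \<noteq> {\<zero>\<^bsub>M\<^esub>}"
  obtains y where "y \<in> N" "primeideal (ann y) R"
proof -
  obtain x where x: "x \<in> N" "x \<noteq> \<zero>\<^bsub>M\<^esub>"
    using N(2) submodule_zero_mem[OF N(1)] by blast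
  have xM: "x \<in> carrier M" using x submoduleE(1)[OF N(1)] by auto
  define S where "S = {s \<in> carrier R. s \<odot>\<^bsub>M\<^esub> x \<noteq> \<zero>\<^bsub>M\<^esub>}"
  have "\<exists>s\<in>S. \<forall>t\<in>S. \<not> ann (s \<odot>\<^bsub>M\<^esub> x) \<subset> ann (t \<odot>\<^bsub>M\<^esub> x)"
  proof (rule ccontr)
    assume "\<not> ?thesis"
    then have step: "\<And>s. s \<in> S \<Longrightarrow> \<exists>t. t \<in> S \<and> ann (s \<odot>\<^bsub>M\<^esub> x) \<subset> ann (t \<odot>\<^bsub>M\<^esub> x)" by blast
    \<comment> \<open>The unit starts the dependent choice, because \<open>x\<close> itself is
      non-zero.\<close>
    have "\<one> \<in> S" using x xM by (simp add: S_def)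
    then obtain s where "\<forall>n::nat. s n \<in> S \<and> ann (s n \<odot>\<^bsub>M\<^esub> x) \<subset> ann (s (Suc n) \<odot>\<^bsub>M\<^esub> x)"
      using dependent_nat_choice[of "\<lambda>_ s. s \<in> S" "\<lambda>_ s t. ann (s \<odot>\<^bsub>M\<^esub> x) \<subset> ann (t \<odot>\<^bsub>M\<^esub> x)"] step
      by metis
    then show False using mononoetherian_no_ann_chain[OF M xM, of s] by (simp add: S_def)
  qed
  then obtain s where s: "s \<in> S" "\<And>t. t \<in> S \<Longrightarrow> \<not> ann (s \<odot>\<^bsub>M\<^esub> x) \<subset> ann (t \<odot>\<^bsub>M\<^esub> x)" by blast
  have "primeideal (ann (s \<odot>\<^bsub>M\<^esub> x)) R"
  proof (rule primeideal_ann_if_maximal)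
    \<comment> \<open>A multiple of \<open>s x\<close> is again a multiple of \<open>x\<close>, so
      maximality among the multiples of \<open>x\<close> suffices.\<close>
    fix r assume "r \<in> carrier R" "r \<odot>\<^bsub>M\<^esub> (s \<odot>\<^bsub>M\<^esub> x) \<noteq> \<zero>\<^bsub>M\<^esub>"
    then show "\<not> ann (s \<odot>\<^bsub>M\<^esub> x) \<subset> ann (r \<odot>\<^bsub>M\<^esub> (s \<odot>\<^bsub>M\<^esub> x))"
      using s(2)[of "r \<otimes> s"] s(1) xM by (simp add: S_def smult_assoc1)
  qed (use s(1) xM in \<open>simp_all add: S_def\<close>)
  moreover have "s \<odot>\<^bsub>M\<^esub> x \<in> N" using s x submoduleE(4)[OF N(1)] by (simp add: S_def)
  ultimately show ?thesis using that by blast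
qed

section \<open>Spans of initial segments and independence of sequences\<close>

primrec span_upto :: "(nat \<Rightarrow> 'c) \<Rightarrow> nat \<Rightarrow> 'c set" where
  "span_upto y 0 = {\<zero>\<^bsub>M\<^esub>}"
| "span_upto y (Suc n) = {u \<oplus>\<^bsub>M\<^esub> r \<odot>\<^bsub>M\<^esub> y n | u r. u \<in> span_upto y n \<and> r \<in> carrier R}"

text \<open>This is directness of the sum of the cyclic submodules \<open>R (y i)\<close>. The
  conclusion concerns \<open>r y n\<close> and not \<open>r\<close>, since the generators may have
  non-zero annihilators. Testing only the last term matches the recursion of
  \<open>span_upto\<close>.\<close>

definition independent_seq :: "(nat \<Rightarrow> 'c) \<Rightarrow> bool" where
  "independent_seq y \<longleftrightarrow> (\<forall>n. \<forall>u\<in>span_upto y n. \<forall>r\<in>carrier R.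
     u \<oplus>\<^bsub>M\<^esub> r \<odot>\<^bsub>M\<^esub> y n = \<zero>\<^bsub>M\<^esub> \<longrightarrow> r \<odot>\<^bsub>M\<^esub> y n = \<zero>\<^bsub>M\<^esub>)"

lemma span_upto_memE:
  assumes "z \<in> span_upto y (Suc n)"
  obtains u r where "u \<in> span_upto y n" "r \<in> carrier R" "z = u \<oplus>\<^bsub>M\<^esub> r \<odot>\<^bsub>M\<^esub> y n"
  using assms by auto

lemma submodule_span_upto:
  assumes y: "\<And>i. y i \<in> carrier M"
  shows "submodule (span_upto y n) R M"
proof (induction n)
  case 0
  then show ?case by (intro submoduleI) auto
next
  case (Suc n)
  note E = submoduleE[OF Suc]
  show ?case
  proof (rule submoduleI)
    show "span_upto y (Suc n) \<subseteq> carrier M" using E(1) y by auto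
    show "\<zero>\<^bsub>M\<^esub> \<in> span_upto y (Suc n)"
      using submodule_zero_mem[OF Suc] y
      by (auto intro!: exI[of _ "\<zero>\<^bsub>M\<^esub>"] exI[of _ "\<zero>"])
  next
    fix a assume "a \<in> span_upto y (Suc n)"
    then obtain u r where u: "u \<in> span_upto y n" "r \<in> carrier R" "a = u \<oplus>\<^bsub>M\<^esub> r \<odot>\<^bsub>M\<^esub> y n"
      by (rule span_upto_memE)
    then have "\<ominus>\<^bsub>M\<^esub> a = \<ominus>\<^bsub>M\<^esub> u \<oplus>\<^bsub>M\<^esub> (\<ominus> r) \<odot>\<^bsub>M\<^esub> y n"
      using E(1) y by (auto simp: M.minus_add smult_l_minus subset_eq)
    then show "\<ominus>\<^bsub>M\<^esub> a \<in> span_upto y (Suc n)" using u E(3) by auto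
  next
    fix a b assume "a \<in> span_upto y (Suc n)" "b \<in> span_upto y (Suc n)"
    then obtain u r v s where u: "u \<in> span_upto y n" "r \<in> carrier R" "a = u \<oplus>\<^bsub>M\<^esub> r \<odot>\<^bsub>M\<^esub> y n"
      and v: "v \<in> span_upto y n" "s \<in> carrier R" "b = v \<oplus>\<^bsub>M\<^esub> s \<odot>\<^bsub>M\<^esub> y n"
      by (metis span_upto_memE)
    then have "a \<oplus>\<^bsub>M\<^esub> b = (u \<oplus>\<^bsub>M\<^esub> v) \<oplus>\<^bsub>M\<^esub> (r \<oplus> s) \<odot>\<^bsub>M\<^esub> y n"
      using E(1) y by (auto simp: M.a_ac smult_l_distr subset_eq)
    then show "a \<oplus>\<^bsub>M\<^esub> b \<in> span_upto y (Suc n)" using u v E(5) by auto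
  next
    fix a b assume ab: "a \<in> carrier R" "b \<in> span_upto y (Suc n)"
    then obtain u r where u: "u \<in> span_upto y n" "r \<in> carrier R" "b = u \<oplus>\<^bsub>M\<^esub> r \<odot>\<^bsub>M\<^esub> y n"
      by (metis span_upto_memE)
    then have "a \<odot>\<^bsub>M\<^esub> b = a \<odot>\<^bsub>M\<^esub> u \<oplus>\<^bsub>M\<^esub> (a \<otimes> r) \<odot>\<^bsub>M\<^esub> y n"
      using E(1) y ab by (auto simp: smult_r_distr smult_assoc1 subset_eq)
    then show "a \<odot>\<^bsub>M\<^esub> b \<in> span_upto y (Suc n)" using u E(4) ab by auto
  qed
qed

lemma span_upto_mono_Suc:
  assumes "\<And>i. y i \<in> carrier M"
  shows "span_upto y n \<subseteq> span_upto y (Suc n)"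
proof
  fix u assume u: "u \<in> span_upto y n"
  then have "u \<in> carrier M" using submoduleE(1)[OF submodule_span_upto[of y n, OF assms]] by auto
  then show "u \<in> span_upto y (Suc n)"
    using u assms by (auto intro!: exI[of _ u] exI[of _ "\<zero>"])
qed

lemma generator_mem_span_upto:
  assumes y: "\<And>i. y i \<in> carrier M" and "i < n"
  shows "y i \<in> span_upto y n"
  using \<open>i < n\<close>
proof (induction n)
  case (Suc n)
  show ?case
  proof (cases "i = n")
    case True
    then show ?thesis using y submodule_zero_mem[OF submodule_span_upto[of y n, OF y]]
      by (auto intro!: exI[of _ "\<zero>\<^bsub>M\<^esub>"] exI[of _ "\<one>"])
  next
    case False
    then show ?thesis using Suc span_upto_mono_Suc[of y n, OF y] by (auto simp del: span_upto.simps)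
  qed
qed simp

lemma finsum_lessThan_Suc:
  assumes "\<And>i. i < Suc k \<Longrightarrow> x i \<in> carrier M"
  shows "(\<Oplus>\<^bsub>M\<^esub>i\<in>{..<Suc k}. x i) = (\<Oplus>\<^bsub>M\<^esub>i\<in>{..<k}. x i) \<oplus>\<^bsub>M\<^esub> x k"
  using assms by (simp add: lessThan_Suc Pi_def M.a_comm)

text \<open>Terms are peeled off from the top: each partial sum lies in the span of its generators,
  so independence kills the last term and leaves a shorter vanishing sum.\<close>

lemma independent_seq_finsum:
  assumes y: "\<And>i. y i \<in> carrier M" and ind: "independent_seq y"
    and c: "\<And>i. i < n \<Longrightarrow> c i \<in> carrier R"
    and 0: "(\<Oplus>\<^bsub>M\<^esub>i\<in>{..<n}. c i \<odot>\<^bsub>M\<^esub> y i) = \<zero>\<^bsub>M\<^esub>" and "i < n"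
  shows "c i \<odot>\<^bsub>M\<^esub> y i = \<zero>\<^bsub>M\<^esub>"
proof -
  have mem: "(\<Oplus>\<^bsub>M\<^esub>i\<in>{..<k}. c i \<odot>\<^bsub>M\<^esub> y i) \<in> span_upto y k" if "k \<le> n" for k
    using that
  proof (induction k)
    case (Suc k)
    have "(\<Oplus>\<^bsub>M\<^esub>i\<in>{..<Suc k}. c i \<odot>\<^bsub>M\<^esub> y i) = (\<Oplus>\<^bsub>M\<^esub>i\<in>{..<k}. c i \<odot>\<^bsub>M\<^esub> y i) \<oplus>\<^bsub>M\<^esub> c k \<odot>\<^bsub>M\<^esub> y k"
      using c y Suc.prems by (intro finsum_lessThan_Suc) auto
    then show ?case using c[of k] Suc by auto
  qed simp
  have "(\<Oplus>\<^bsub>M\<^esub>i\<in>{..<k}. c i \<odot>\<^bsub>M\<^esub> y i) = \<zero>\<^bsub>M\<^esub> \<Longrightarrow> i < k \<Longrightarrow> k \<le> n \<Longrightarrow> ?thesis" for k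
  proof (induction k)
    case (Suc k)
    let ?u = "\<Oplus>\<^bsub>M\<^esub>i\<in>{..<k}. c i \<odot>\<^bsub>M\<^esub> y i"
    have u: "?u \<in> carrier M" using c y Suc by (auto intro!: M.finsum_closed)
    have "(\<Oplus>\<^bsub>M\<^esub>i\<in>{..<Suc k}. c i \<odot>\<^bsub>M\<^esub> y i) = ?u \<oplus>\<^bsub>M\<^esub> c k \<odot>\<^bsub>M\<^esub> y k"
      using c y Suc.prems by (intro finsum_lessThan_Suc) auto
    then have e: "?u \<oplus>\<^bsub>M\<^esub> c k \<odot>\<^bsub>M\<^esub> y k = \<zero>\<^bsub>M\<^esub>" using Suc.prems by simp
    then have k0: "c k \<odot>\<^bsub>M\<^esub> y k = \<zero>\<^bsub>M\<^esub>"
      using ind mem[of k] c[of k] Suc.prems by (auto simp: independent_seq_def)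
    then have "?u = \<zero>\<^bsub>M\<^esub>" using e u by simp
    then show ?case using Suc k0 by (cases "i = k") auto
  qed simp
  then show ?thesis using 0 \<open>i < n\<close> by blast
qed

section \<open>Obstructions to embedding a span in a shorter one: associated primes and rank\<close>

text \<open>Write \<open>z = u + v\<close> with \<open>u\<close> in the shorter span and
  \<open>v\<close> a multiple of the last generator. Independence gives
  \<open>ann z = ann u \<inter> ann v\<close>, and a prime ideal that is the intersection of two
  ideals equals one of them. The first is handled by induction, the second by
  \<open>ann_smult_of_prime\<close>.\<close>

lemma prime_ann_span_upto:
  assumes y: "\<And>i. y i \<in> carrier M" "\<And>i. primeideal (ann (y i)) R" and ind: "independent_seq y"
    and z: "z \<in> span_upto y n" "primeideal (ann z) R"
  shows "\<exists>i<n. ann z = ann (y i)"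
  using z
proof (induction n arbitrary: z)
  case 0
  \<comment> \<open>The empty span contains only zero, whose annihilator is not proper.\<close>
  then have "ann z = carrier R" by (auto simp: ann_def)
  then show ?case using primeideal.I_notcarr[OF 0(2)] by simp
next
  case (Suc n)
  obtain u r where u: "u \<in> span_upto y n" and r: "r \<in> carrier R" and z: "z = u \<oplus>\<^bsub>M\<^esub> r \<odot>\<^bsub>M\<^esub> y n"
    using Suc.prems(1) by (rule span_upto_memE)
  define v where "v = r \<odot>\<^bsub>M\<^esub> y n"
  have zv: "z = u \<oplus>\<^bsub>M\<^esub> v" by (simp add: z v_def)
  note S = submodule_span_upto[of y n, OF y(1)]
  have uM: "u \<in> carrier M" and vM: "v \<in> carrier M"
    using u submoduleE(1)[OF S] r y by (auto simp: v_def)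
  have inter: "ann z = ann u \<inter> ann v"
  proof
    show "ann u \<inter> ann v \<subseteq> ann z" using uM vM by (auto simp: ann_def zv smult_r_distr)
    show "ann z \<subseteq> ann u \<inter> ann v"
    proof
      fix a assume "a \<in> ann z"
      then have a: "a \<in> carrier R" and e: "a \<odot>\<^bsub>M\<^esub> u \<oplus>\<^bsub>M\<^esub> a \<odot>\<^bsub>M\<^esub> v = \<zero>\<^bsub>M\<^esub>"
        using uM vM by (auto simp: ann_def zv smult_r_distr)
      have av: "a \<odot>\<^bsub>M\<^esub> v = (a \<otimes> r) \<odot>\<^bsub>M\<^esub> y n" using a r y by (simp add: v_def smult_assoc1)
      \<comment> \<open>\<open>a u\<close> stays in the shorter span, so independence applies to the
        vanishing sum \<open>a u + a v\<close>.\<close>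
      then have v0: "a \<odot>\<^bsub>M\<^esub> v = \<zero>\<^bsub>M\<^esub>"
        using ind[unfolded independent_seq_def, rule_format, OF submoduleE(4)[OF S a u], of "a \<otimes> r"]
          e a r by simp
      then show "a \<in> ann u \<inter> ann v" using e a uM by (auto simp: ann_def)
    qed
  qed
  have "ann u \<subseteq> ann z \<or> ann v \<subseteq> ann z"
  proof (rule ccontr)
    assume "\<not> ?thesis"
    then obtain a b where ab: "a \<in> ann u" "a \<notin> ann z" "b \<in> ann v" "b \<notin> ann z"
      by blast
    then have c: "a \<in> carrier R" "b \<in> carrier R" by (auto simp: ann_def)
    \<comment> \<open>The product of an element of \<open>ann u\<close> and one of
      \<open>ann v\<close> lies in both ideals, hence in \<open>ann z\<close>, against
      primality.\<close>
    have "a \<otimes> b \<in> ann z"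
      unfolding inter using ideal.I_l_closed[OF ideal_ann[OF vM] ab(3) c(1)]
        ideal.I_r_closed[OF ideal_ann[OF uM] ab(1) c(2)] by simp
    then show False using primeideal.I_prime[OF Suc.prems(2) c] ab(2,4) by simp
  qed
  then consider "ann z = ann u" | "ann z = ann v" unfolding inter by blast
  then show ?case
  proof cases
    case 1
    then have "primeideal (ann u) R" using Suc.prems(2) by simp
    then obtain i where "i < n" "ann u = ann (y i)" using Suc.IH[OF u] by blast
    then show ?thesis using 1 by (intro exI[of _ i]) simp
  next
    case 2
    have "v \<noteq> \<zero>\<^bsub>M\<^esub>"
    proof
      assume "v = \<zero>\<^bsub>M\<^esub>"
      then have "ann v = carrier R" by (auto simp: ann_def)
      then show False using primeideal.I_notcarr[OF Suc.prems(2)] 2 by simp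
    qed
    then have "ann z = ann (y n)" using 2 ann_smult_of_prime[of "y n" r, OF y r] by (simp add: v_def)
    then show ?thesis by blast
  qed
qed

text \<open>Fraction-free Gaussian elimination, by induction on the number of generators. The span
  is killed by \<open>P\<close>, hence a module over the domain \<open>R/P\<close>, where a
  coefficient outside \<open>P\<close> is a non-zero one.\<close>

lemma linear_dependence_mod_prime:
  assumes P: "primeideal P R" and y: "\<And>i. y i \<in> carrier M" "\<And>i p. p \<in> P \<Longrightarrow> p \<odot>\<^bsub>M\<^esub> y i = \<zero>\<^bsub>M\<^esub>"
    and J: "finite J" "card J > n" and w: "\<And>j. j \<in> J \<Longrightarrow> w j \<in> span_upto y n"
  shows "\<exists>c. c \<in> J \<rightarrow> carrier R \<and> (\<exists>j\<in>J. c j \<notin> P) \<and> (\<Oplus>\<^bsub>M\<^esub>j\<in>J. c j \<odot>\<^bsub>M\<^esub> w j) = \<zero>\<^bsub>M\<^esub>"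
  using J w
proof (induction n arbitrary: J w)
  case 0
  \<comment> \<open>All \<open>w j\<close> are zero, so any coefficients outside \<open>P\<close>
    serve; \<open>\<one>\<close> is outside because \<open>P\<close> is proper.\<close>
  have "\<one> \<notin> P" using primeideal.I_notcarr[OF P] ideal.one_imp_carrier[OF primeideal.axioms(1)[OF P]] by auto
  moreover have "J \<noteq> {}" using 0 by auto
  moreover have "(\<Oplus>\<^bsub>M\<^esub>j\<in>J. \<one> \<odot>\<^bsub>M\<^esub> w j) = (\<Oplus>\<^bsub>M\<^esub>j\<in>J. \<zero>\<^bsub>M\<^esub>)"
    using 0 by (intro M.finsum_cong') auto
  ultimately show ?case by (intro exI[of _ "\<lambda>_. \<one>"]) (auto simp: M.finsum_zero)
next
  case (Suc n)
  note S = submodule_span_upto[of y n, OF y(1)]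
  note SM = submoduleE(1)[OF S]
  have "\<forall>j\<in>J. \<exists>u r. u \<in> span_upto y n \<and> r \<in> carrier R \<and> w j = u \<oplus>\<^bsub>M\<^esub> r \<odot>\<^bsub>M\<^esub> y n"
    using Suc.prems(3) by (metis span_upto_memE)
  then obtain u a where u: "\<And>j. j \<in> J \<Longrightarrow> u j \<in> span_upto y n"
    and a: "\<And>j. j \<in> J \<Longrightarrow> a j \<in> carrier R"
    and wj: "\<And>j. j \<in> J \<Longrightarrow> w j = u j \<oplus>\<^bsub>M\<^esub> a j \<odot>\<^bsub>M\<^esub> y n"
    by metis
  have uM: "\<And>j. j \<in> J \<Longrightarrow> u j \<in> carrier M" using u SM by auto
  have wM: "\<And>j. j \<in> J \<Longrightarrow> w j \<in> carrier M" using wj uM a y by simp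
  show ?case
  proof (cases "\<forall>j\<in>J. a j \<in> P")
    case True
    \<comment> \<open>Coefficients in \<open>P\<close> kill \<open>y n\<close>, so the vectors
      already lie in the shorter span.\<close>
    then have "\<And>j. j \<in> J \<Longrightarrow> w j \<in> span_upto y n" using wj u uM y by simp
    then show ?thesis using Suc by simp
  next
    case False
    then obtain k where k: "k \<in> J" "a k \<notin> P" by blast
    \<comment> \<open>Gaussian elimination of the last coordinate, with pivot \<open>a k\<close>.\<close>
    define J' where "J' = J - {k}"
    define v where "v j = a k \<odot>\<^bsub>M\<^esub> u j \<ominus>\<^bsub>M\<^esub> a j \<odot>\<^bsub>M\<^esub> u k" for j
    have v: "v j \<in> span_upto y n" if "j \<in> J'" for j
      unfolding v_def a_minus_def
      using that k a u by (auto intro!: submoduleE(3-5)[OF S] simp: J'_def)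
    \<comment> \<open>The multiples of \<open>y n\<close> cancel, and \<open>v j\<close> becomes a
      combination of \<open>w j\<close> and \<open>w k\<close>, so a relation among the
      \<open>v j\<close> turns into one among the \<open>w j\<close>.\<close>
    have vw: "v j = a k \<odot>\<^bsub>M\<^esub> w j \<oplus>\<^bsub>M\<^esub> (\<ominus> a j) \<odot>\<^bsub>M\<^esub> w k" if "j \<in> J'" for j
    proof -
      have j: "j \<in> J" using that by (simp add: J'_def)
      have "a k \<odot>\<^bsub>M\<^esub> (a j \<odot>\<^bsub>M\<^esub> y n) = a j \<odot>\<^bsub>M\<^esub> (a k \<odot>\<^bsub>M\<^esub> y n)"
        using a j k y by (intro smult_commute) auto
      then show ?thesis using wj[OF j] wj[OF k(1)] uM[OF j] uM[OF k(1)] a[OF j] a[OF k(1)] y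
        by (simp add: v_def smult_r_distr smult_l_minus a_minus_def
            M.minus_add M.a_ac M.r_neg M.r_neg1 M.r_neg2)
    qed
    have J': "finite J'" "k \<notin> J'" "J = insert k J'" "n < card J'"
      using k Suc.prems(1,2) by (auto simp: J'_def)
    obtain c where c: "c \<in> J' \<rightarrow> carrier R" "\<exists>j\<in>J'. c j \<notin> P"
      and cv: "(\<Oplus>\<^bsub>M\<^esub>j\<in>J'. c j \<odot>\<^bsub>M\<^esub> v j) = \<zero>\<^bsub>M\<^esub>"
      using Suc.IH[of J' v, OF J'(1,4)] v by blast
    have cR: "c j \<in> carrier R" "a j \<in> carrier R" "w j \<in> carrier M" if "j \<in> J'" for j
      using c(1) a wM J'(3) that by auto
    \<comment> \<open>Substituting \<open>vw\<close> into the relation gives each \<open>w j\<close>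
      the coefficient \<open>c j a k\<close> and collects the multiples of \<open>w k\<close> into
      \<open>b\<close>.\<close>
    define b where "b = (\<Oplus>j\<in>J'. c j \<otimes> (\<ominus> a j))"
    define d where "d j = (if j = k then b else c j \<otimes> a k)" for j
    have bR: "b \<in> carrier R" unfolding b_def using cR by (intro R.finsum_closed) auto
    have bw: "(\<Oplus>\<^bsub>M\<^esub>j\<in>T. (c j \<otimes> (\<ominus> a j)) \<odot>\<^bsub>M\<^esub> w k) = (\<Oplus>j\<in>T. c j \<otimes> (\<ominus> a j)) \<odot>\<^bsub>M\<^esub> w k"
      if "finite T" "T \<subseteq> J'" for T
      using that
    proof (induction T rule: finite_induct)
      case empty
      then show ?case using wM k by simp
    next
      case (insert t T)
      have "c t \<in> carrier R" "a t \<in> carrier R" "c \<in> T \<rightarrow> carrier R" "a \<in> T \<rightarrow> carrier R"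
        using insert.prems cR by auto
      then show ?case using insert wM[OF k(1)] by (simp add: Pi_def smult_l_distr)
    qed
    have "\<zero>\<^bsub>M\<^esub> = (\<Oplus>\<^bsub>M\<^esub>j\<in>J'. (c j \<otimes> a k) \<odot>\<^bsub>M\<^esub> w j \<oplus>\<^bsub>M\<^esub> (c j \<otimes> (\<ominus> a j)) \<odot>\<^bsub>M\<^esub> w k)"
      unfolding cv[symmetric] using cR a[OF k(1)] wM[OF k(1)]
      by (intro M.finsum_cong') (auto simp: vw smult_r_distr smult_assoc1)
    also have "\<dots> = (\<Oplus>\<^bsub>M\<^esub>j\<in>J'. (c j \<otimes> a k) \<odot>\<^bsub>M\<^esub> w j) \<oplus>\<^bsub>M\<^esub> b \<odot>\<^bsub>M\<^esub> w k"
      unfolding b_def using cR a[OF k(1)] wM[OF k(1)] bw[OF J'(1) order_refl] by (subst M.finsum_addf) auto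
    also have "(\<Oplus>\<^bsub>M\<^esub>j\<in>J'. (c j \<otimes> a k) \<odot>\<^bsub>M\<^esub> w j) = (\<Oplus>\<^bsub>M\<^esub>j\<in>J'. d j \<odot>\<^bsub>M\<^esub> w j)"
      using cR a[OF k(1)] wM[OF k(1)] bR J'(2) by (intro M.finsum_cong') (auto simp: d_def)
    also have "\<dots> \<oplus>\<^bsub>M\<^esub> b \<odot>\<^bsub>M\<^esub> w k = b \<odot>\<^bsub>M\<^esub> w k \<oplus>\<^bsub>M\<^esub> (\<Oplus>\<^bsub>M\<^esub>j\<in>J'. d j \<odot>\<^bsub>M\<^esub> w j)"
      using cR a[OF k(1)] wM[OF k(1)] J'(1,2) bR by (intro M.a_comm M.finsum_closed) (auto simp: d_def)
    also have "\<dots> = (\<Oplus>\<^bsub>M\<^esub>j\<in>J. d j \<odot>\<^bsub>M\<^esub> w j)"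
      unfolding J'(3) using cR a[OF k(1)] wM[OF k(1)] J'(1,2) bR by (subst M.finsum_insert) (auto simp: d_def)
    finally have "(\<Oplus>\<^bsub>M\<^esub>j\<in>J. d j \<odot>\<^bsub>M\<^esub> w j) = \<zero>\<^bsub>M\<^esub>" by simp
    moreover have "d \<in> J \<rightarrow> carrier R" using cR(1) a[OF k(1)] bR J'(3) by (auto simp: d_def)
    moreover have "\<exists>j\<in>J. d j \<notin> P"
    proof -
      obtain j where j: "j \<in> J'" "c j \<notin> P" using c by blast
      \<comment> \<open>Primality keeps the relation non-trivial: the old coefficient and the pivot
        both avoid \<open>P\<close>.\<close>
      then have "c j \<otimes> a k \<notin> P" using primeideal.I_prime[OF P, of "c j" "a k"] k a cR(1) by auto
      then show ?thesis using j J' by (intro bexI[of _ j]) (auto simp: d_def)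
    qed
    ultimately show ?thesis by blast
  qed
qed

text \<open>One embedding \<open>f\<close> of the span of \<open>n + 1\<close> generators into the
  span of \<open>n\<close> refutes both patterns. For distinct annihilators, \<open>f (y n)\<close>
  has one not occurring among the first \<open>n\<close>; for equal ones, a dependence among the
  \<open>n + 1\<close> images pulls back to the independent \<open>y\<close>.\<close>

lemma mononoetherian_ann_not_inj_nor_const:
  assumes M: "mononoetherian R M"
    and y: "\<And>i. y i \<in> carrier M" "\<And>i. primeideal (ann (y i)) R" and ind: "independent_seq y"
  shows "\<not> inj (\<lambda>i. ann (y i))" "\<not> (\<forall>i. ann (y i) = P)"
proof -
  note S = submodule_span_upto[of y, OF y(1)]
  obtain n where "module_embedded R (M\<lparr>carrier := span_upto y (Suc n)\<rparr>) (M\<lparr>carrier := span_upto y n\<rparr>)"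
    using M S span_upto_mono_Suc[of y, OF y(1)] unfolding mononoetherian_def
    by (meson le_SucI order_refl)
  then obtain f where f: "f \<in> module_hom R (M\<lparr>carrier := span_upto y (Suc n)\<rparr>) (M\<lparr>carrier := span_upto y n\<rparr>)"
    and inj: "inj_on f (span_upto y (Suc n))"
    by (auto simp: module_embedded_def)
  have f_mem: "f z \<in> span_upto y n" if "z \<in> span_upto y (Suc n)" for z
    using f that by (auto simp: module_hom_def)
  have f_eq_0: "f z = \<zero>\<^bsub>M\<^esub> \<longleftrightarrow> z = \<zero>\<^bsub>M\<^esub>" if "z \<in> span_upto y (Suc n)" for z
    using inj_onD[OF inj] that submodule_zero_mem[OF S] module_hom_restrict_zero[OF f S S] by metis
  have y_mem: "y i \<in> span_upto y (Suc n)" if "i < Suc n" for i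
    using generator_mem_span_upto[of y, OF y(1) that] .
  show "\<not> inj (\<lambda>i. ann (y i))"
  proof
    assume inj: "inj (\<lambda>i. ann (y i))"
    \<comment> \<open>An injective homomorphism preserves annihilators, so the prime of
      \<open>y n\<close> reappears in the shorter span.\<close>
    have "ann (f (y n)) = ann (y n)"
      using f_eq_0[OF submoduleE(4)[OF S _ y_mem[of n]]] module_hom_restrict_smult[OF f _ y_mem[of n]]
      by (auto simp: ann_def)
    then obtain i where "i < n" "ann (y n) = ann (y i)"
      using prime_ann_span_upto[of y "f (y n)" n] y ind f_mem y_mem by (metis lessI)
    then show False using injD[OF inj, of n i] by simp
  qed
  show "\<not> (\<forall>i. ann (y i) = P)"
  proof
    assume P: "\<forall>i. ann (y i) = P"
    \<comment> \<open>The images of \<open>y 0\<close> to \<open>y n\<close> are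
      \<open>n + 1\<close> vectors in a span of \<open>n\<close> generators.\<close>
    have "\<exists>c. c \<in> {..<Suc n} \<rightarrow> carrier R \<and> (\<exists>j\<in>{..<Suc n}. c j \<notin> P) \<and>
        (\<Oplus>\<^bsub>M\<^esub>j\<in>{..<Suc n}. c j \<odot>\<^bsub>M\<^esub> f (y j)) = \<zero>\<^bsub>M\<^esub>"
    proof (rule linear_dependence_mod_prime[where y = y and n = n])
      show "primeideal P R" using y(2)[of 0] P by simp
      show "p \<odot>\<^bsub>M\<^esub> y i = \<zero>\<^bsub>M\<^esub>" if "p \<in> P" for i p
        using P that by (auto simp: ann_def)
    qed (use y f_mem y_mem in \<open>simp_all del: span_upto.simps\<close>)
    then obtain c j where c: "c \<in> {..<Suc n} \<rightarrow> carrier R" and j: "j < Suc n" "c j \<notin> P"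
      and s: "(\<Oplus>\<^bsub>M\<^esub>j\<in>{..<Suc n}. c j \<odot>\<^bsub>M\<^esub> f (y j)) = \<zero>\<^bsub>M\<^esub>" by auto
    have cy: "c i \<odot>\<^bsub>M\<^esub> y i \<in> span_upto y (Suc n)" if "i \<in> {..<Suc n}" for i
      using submoduleE(4)[OF S _ y_mem[of i]] funcset_mem[OF c that] that by blast
    have fs: "(\<Oplus>\<^bsub>M\<^esub>j\<in>{..<Suc n}. c j \<odot>\<^bsub>M\<^esub> y j) \<in> span_upto y (Suc n)"
      "f (\<Oplus>\<^bsub>M\<^esub>j\<in>{..<Suc n}. c j \<odot>\<^bsub>M\<^esub> y j) = (\<Oplus>\<^bsub>M\<^esub>j\<in>{..<Suc n}. f (c j \<odot>\<^bsub>M\<^esub> y j))"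
      using module_hom_restrict_finsum[OF f S S finite_lessThan, of "Suc n" "\<lambda>i. c i \<odot>\<^bsub>M\<^esub> y i"] cy
      by blast+
    have "f (y j) \<in> carrier M" "f (c j \<odot>\<^bsub>M\<^esub> y j) = c j \<odot>\<^bsub>M\<^esub> f (y j)" if "j \<in> {..<Suc n}" for j
      using that module_hom_restrict_smult[OF f, of "c j" "y j"] y_mem[of j] funcset_mem[OF c that]
        f_mem[of "y j"] submoduleE(1)[OF S, of n] by (auto simp del: span_upto.simps)
    then have "(\<Oplus>\<^bsub>M\<^esub>j\<in>{..<Suc n}. f (c j \<odot>\<^bsub>M\<^esub> y j)) = (\<Oplus>\<^bsub>M\<^esub>j\<in>{..<Suc n}. c j \<odot>\<^bsub>M\<^esub> f (y j))"
      using c by (intro M.finsum_cong') auto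
    then have "(\<Oplus>\<^bsub>M\<^esub>j\<in>{..<Suc n}. c j \<odot>\<^bsub>M\<^esub> y j) = \<zero>\<^bsub>M\<^esub>"
      using f_eq_0[OF fs(1)] fs(2) s by simp
    \<comment> \<open>Independence makes the term at \<open>j\<close> vanish, so \<open>c j\<close>
      lies in \<open>ann (y j) = P\<close>, against its choice.\<close>
    then have "c j \<odot>\<^bsub>M\<^esub> y j = \<zero>\<^bsub>M\<^esub>"
      using independent_seq_finsum[of y, OF y(1) ind _ _ j(1)] c by auto
    then show False using j P c by (auto simp: ann_def)
  qed
qed

section \<open>Independent sequences from direct sums\<close>

text \<open>An element \<open>u\<close> of \<open>span_upto y n\<close> is a sum of components in
  the first \<open>n\<close> summands, so a vanishing \<open>u + r y n\<close> is a representation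
  of zero in the direct sum, and its components vanish.\<close>

lemma independent_seq_of_direct_sum:
  assumes S: "direct_sum_of_submodules R M S" and g: "inj g" "\<And>i::nat. g i \<in> S"
    and y: "\<And>i. y i \<in> g i"
  shows "independent_seq y"
proof -
  have sub: "\<And>i. submodule (g i) R M" using S g by (auto simp: direct_sum_of_submodules_def)
  have gM: "\<And>i. g i \<subseteq> carrier M" using submoduleE(1)[OF sub] .
  \<comment> \<open>The component at \<open>n\<close> is prescribed in advance: the induction uses
    this to append the next term, the application to append \<open>r y n\<close>.\<close>
  have fs: "\<exists>x. (\<forall>i. x i \<in> g i) \<and> u = (\<Oplus>\<^bsub>M\<^esub>i\<in>{..<n}. x i) \<and> x n = v"
    if "u \<in> span_upto y n" "v \<in> g n" for u v n
    using that
  proof (induction n arbitrary: u v)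
    case 0
    then show ?case using submodule_zero_mem[OF sub]
      by (intro exI[of _ "(\<lambda>_. \<zero>\<^bsub>M\<^esub>)(0 := v)"]) auto
  next
    case (Suc n)
    obtain u' r where u': "u' \<in> span_upto y n" "r \<in> carrier R" "u = u' \<oplus>\<^bsub>M\<^esub> r \<odot>\<^bsub>M\<^esub> y n"
      using Suc.prems(1) by (rule span_upto_memE)
    have "r \<odot>\<^bsub>M\<^esub> y n \<in> g n" using u' submoduleE(4)[OF sub] y by blast
    then obtain x where x: "\<And>i. x i \<in> g i" "u' = (\<Oplus>\<^bsub>M\<^esub>i\<in>{..<n}. x i)" "x n = r \<odot>\<^bsub>M\<^esub> y n"
      using Suc.IH[OF u'(1)] by metis
    \<comment> \<open>Overwriting the component at \<open>Suc n\<close> leaves the sum over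
      \<open>{..<Suc n}\<close> unchanged.\<close>
    define x' where "x' = x(Suc n := v)"
    have xM: "x i \<in> carrier M" for i using x(1) gM by blast
    have "(\<Oplus>\<^bsub>M\<^esub>i\<in>{..<Suc n}. x' i) = (\<Oplus>\<^bsub>M\<^esub>i\<in>{..<Suc n}. x i)"
      using xM by (intro M.finsum_cong') (auto simp: x'_def)
    also have "\<dots> = u" using xM x(2,3) u'(3) by (simp add: finsum_lessThan_Suc)
    finally show ?case using x Suc.prems(2) by (intro exI[of _ x']) (auto simp: x'_def)
  qed
  show ?thesis
    unfolding independent_seq_def
  proof (intro allI ballI impI)
    fix n u r assume u: "u \<in> span_upto y n" and r: "r \<in> carrier R"
      and e: "u \<oplus>\<^bsub>M\<^esub> r \<odot>\<^bsub>M\<^esub> y n = \<zero>\<^bsub>M\<^esub>"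
    have "r \<odot>\<^bsub>M\<^esub> y n \<in> g n" using r submoduleE(4)[OF sub] y by blast
    then obtain x where x: "\<And>i. x i \<in> g i" "u = (\<Oplus>\<^bsub>M\<^esub>i\<in>{..<n}. x i)" "x n = r \<odot>\<^bsub>M\<^esub> y n"
      using fs[OF u] by metis
    have xM: "x i \<in> carrier M" for i using x(1) gM by blast
    have "(\<Oplus>\<^bsub>M\<^esub>i\<in>{..<Suc n}. x i) = \<zero>\<^bsub>M\<^esub>" using xM x(2,3) e
      by (simp add: finsum_lessThan_Suc)
    \<comment> \<open>Directness is stated for selections indexed by the submodules themselves, so
      the sum is reindexed along the injective \<open>g\<close>.\<close>
    moreover have "(\<Oplus>\<^bsub>M\<^esub>N\<in>g ` {..<Suc n}. x (inv_into UNIV g N)) = (\<Oplus>\<^bsub>M\<^esub>i\<in>{..<Suc n}. x (inv_into UNIV g (g i)))"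
      using xM g(1) by (intro M.finsum_reindex) (auto intro: inj_on_subset)
    ultimately have s: "(\<Oplus>\<^bsub>M\<^esub>N\<in>g ` {..<Suc n}. x (inv_into UNIV g N)) = \<zero>\<^bsub>M\<^esub>" using g(1) by simp
    have "\<forall>N\<in>g ` {..<Suc n}. x (inv_into UNIV g N) = \<zero>\<^bsub>M\<^esub>"
      using S unfolding direct_sum_of_submodules_def
      by (elim conjE allE[of _ "g ` {..<Suc n}"] allE[of _ "\<lambda>N. x (inv_into UNIV g N)"] impE)
        (use s x(1) g in auto)
    then show "r \<odot>\<^bsub>M\<^esub> y n = \<zero>\<^bsub>M\<^esub>" using g(1) x(3) by auto
  qed
qed

end

section \<open>Distinct or equal primes along a sequence of summands\<close>

text \<open>If \<open>h\<close> takes infinitely many values on \<open>S\<close>, one preimage is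
  chosen for each of countably many of them; otherwise some fibre is infinite by the pigeonhole
  principle.\<close>

lemma infinite_subset_inj_or_const:
  assumes "infinite S"
  obtains g :: "nat \<Rightarrow> 'a" where "inj g" "range g \<subseteq> S" "inj (\<lambda>i. h (g i))"
  | g :: "nat \<Rightarrow> 'a" and P where "inj g" "range g \<subseteq> S" "\<And>i. h (g i) = P"
proof (cases "finite (h ` S)")
  case True
  then obtain a where "a \<in> S" "infinite {b \<in> S. h b = h a}"
    using pigeonhole_infinite[OF assms] by blast
  then obtain g :: "nat \<Rightarrow> 'a" where "inj g" "range g \<subseteq> {b \<in> S. h b = h a}"
    using infinite_countable_subset by blast
  then show ?thesis using that(2)[of g "h a"] by blast
next
  case False
  then obtain k :: "nat \<Rightarrow> 'b" where k: "inj k" "range k \<subseteq> h ` S"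
    using infinite_countable_subset by blast
  \<comment> \<open>Since \<open>h (g i) = k i\<close>, injectivity of \<open>k\<close> passes to
    \<open>g\<close> as well.\<close>
  define g where "g i = inv_into S h (k i)" for i
  have "h (g i) = k i" "g i \<in> S" for i
    using k(2) by (auto simp: g_def intro!: f_inv_into_f inv_into_into)
  then show ?thesis using that(1)[of g] k(1) by (simp add: inj_def image_subset_iff) metis
qed

theorem proposition3p27:
  fixes R :: "('a, 'm) ring_scheme" and M :: "('a, 'b, 'n) module_scheme"
  assumes "cring R"
    and "module R M"
    and "mononoetherian R M"
  shows "finite_uniform_dimension R M"
proof -
  interpret module R M by fact
  show ?thesis
    unfolding finite_uniform_dimension_def
  proof
    assume "\<exists>S. infinite S \<and> (\<forall>N\<in>S. N \<noteq> {\<zero>\<^bsub>M\<^esub>}) \<and> direct_sum_of_submodules R M S"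
    then obtain S where inf: "infinite S" and nz: "\<And>N. N \<in> S \<Longrightarrow> N \<noteq> {\<zero>\<^bsub>M\<^esub>}"
      and S: "direct_sum_of_submodules R M S" by blast
    have sub: "\<And>N. N \<in> S \<Longrightarrow> submodule N R M" using S by (simp add: direct_sum_of_submodules_def)
    \<comment> \<open>Each summand contributes one vector with prime annihilator \<open>P\<close>,
      which generates a copy of \<open>R/P\<close>.\<close>
    have "\<forall>N\<in>S. \<exists>y. y \<in> N \<and> primeideal (ann y) R"
      using mononoetherian_prime_ann[OF assms(3) sub nz] by metis
    then obtain y where y: "\<And>N. N \<in> S \<Longrightarrow> y N \<in> N" "\<And>N. N \<in> S \<Longrightarrow> primeideal (ann (y N)) R"
      by metis
    have no: "\<not> inj (\<lambda>i. ann (y (g i)))" "\<not> (\<forall>i. ann (y (g i)) = P)"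
      if g: "inj g" "range g \<subseteq> S" for g :: "nat \<Rightarrow> 'b set" and P
    proof -
      have gS: "g i \<in> S" for i using g by blast
      have "y (g i) \<in> carrier M" for i using y(1)[OF gS] submoduleE(1)[OF sub[OF gS]] by blast
      moreover have "independent_seq (\<lambda>i. y (g i))"
        using independent_seq_of_direct_sum[OF S g(1) gS y(1)[OF gS]] .
      ultimately show "\<not> inj (\<lambda>i. ann (y (g i)))" "\<not> (\<forall>i. ann (y (g i)) = P)"
        using mononoetherian_ann_not_inj_nor_const[OF assms(3), of "\<lambda>i. y (g i)"] y(2)[OF gS]
        by simp_all
    qed
    \<comment> \<open>Along some sequence of distinct summands the chosen primes are pairwise
      distinct or all equal, and \<open>no\<close> excludes both.\<close>
    show False
      by (rule infinite_subset_inj_or_const[OF inf, of "\<lambda>N. ann (y N)"]) (use no in blast)+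
  qed
qed

end
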